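(* Let $G$ be a spinal Hanoi towers group acting on $\mathcal T_d$, and let $g\in\mathrm{St}_G(1)$ with $\psi(g)=(g_1,\ldots,g_d)$. Then $$\varepsilon(g)=\sum_{j=1}^d\varepsilon(g_j).$$
   Context: $\mathcal T_d$ is the $d$-regular rooted tree whose vertices are the finite words over $\{1,\dots,d\}$. Automorphisms and permutations act on the right and products are read from left to right. For $g\in\mathrm{Aut}(\mathcal T_d)$ and a vertex $v$, the section $g|_v$ is defined by $(vw)^g=v^g\,w^{g|_v}$; we write $\psi(g)=(g|_1,\dots,g|_d)\tau$, where $\tau$ is the action of $g$ on the first level ($\tau$ is omitted when trivial). $\mathrm{St}_G(1)$ is the subgroup of elements of $G$ fixing every vertex of the first level. Given $\sigma_1,\dots,\sigma_d\in\mathrm{Sym}(d)$ with $\sigma_i\neq 1$ and $\sigma_i$ fixing $i$ for each $i$, let $a_i\in\mathrm{Aut}(\mathcal T_d)$ be defined recursively by $\psi(a_i)=(1,\dots,1,a_i,1,\dots,1)\sigma_i$, with $a_i$ in the $i$-th coordinate. Any group $G=\langle a_1,\dots,a_d\rangle$ of this form is a spinal Hanoi towers group. The order $o(a_i)$ is finite. All sections of elements of $G$ lie in $G$. $\varepsilon:G\to\prod_{i=1}^d\mathbb Z/o(a_i)\mathbb Z$ is the (well-defined) homomorphism sending $a_i$ to the $i$-th standard generator; its $i$-th coordinate on $g$ is the total exponent, modulo $o(a_i)$, of $a_i$ in any word representing $g$. *)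

theory Defs
  imports "HOL-Algebra.Algebra"
begin

text \<open>
  The alphabet \<open>{1,\<dots>,d}\<close> is a finite type \<open>'d\<close> with \<open>d = CARD('d)\<close>; the vertices of the
  \<open>d\<close>-regular rooted tree are the words of type \<open>'d list\<close>, with the empty word as root.
  Actions are on the right, so the vertex \<open>v\<^sup>g\<close> is written \<open>g v\<close>.
\<close>

definition child_of :: "'d list \<Rightarrow> 'd list \<Rightarrow> bool" where
  "child_of w v \<longleftrightarrow> (\<exists>x. w = v @ [x])"

definition tree_aut :: "('d list \<Rightarrow> 'd list) \<Rightarrow> bool" where
  "tree_aut g \<longleftrightarrow> bij g \<and> g [] = [] \<and> (\<forall>v w. child_of (g w) (g v) \<longleftrightarrow> child_of w v)"

text \<open>Products are read from left to right: \<open>g \<otimes> h\<close> applies \<open>g\<close> first.\<close>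

definition Aut_tree :: "('d list \<Rightarrow> 'd list) monoid" where
  "Aut_tree = \<lparr>carrier = {g. tree_aut g}, monoid.mult = (\<lambda>g h. h \<circ> g), one = id\<rparr>"

text \<open>For an automorphism \<open>g\<close>, \<open>g (v @ w)\<close> extends \<open>g v\<close>, which has the same length as \<open>v\<close>;
  the remaining suffix is the image of \<open>w\<close> under the section.\<close>

definition tree_section :: "('d list \<Rightarrow> 'd list) \<Rightarrow> 'd list \<Rightarrow> 'd list \<Rightarrow> 'd list" where
  "tree_section g v w = drop (length v) (g (v @ w))"

definition first_level_action :: "('d list \<Rightarrow> 'd list) \<Rightarrow> 'd \<Rightarrow> 'd" where
  "first_level_action g x = hd (g [x])"

definition psi :: "('d list \<Rightarrow> 'd list) \<Rightarrow> ('d \<Rightarrow> 'd list \<Rightarrow> 'd list) \<times> ('d \<Rightarrow> 'd)" where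
  "psi g = ((\<lambda>j. tree_section g [j]), first_level_action g)"

definition level_one_stabilizer :: "('d list \<Rightarrow> 'd list) monoid \<Rightarrow> ('d list \<Rightarrow> 'd list) set" where
  "level_one_stabilizer G = {g \<in> carrier G. \<forall>v. length v = 1 \<longrightarrow> g v = v}"

definition spinal_hanoi_perms :: "('d \<Rightarrow> 'd \<Rightarrow> 'd) \<Rightarrow> bool" where
  "spinal_hanoi_perms \<sigma> \<longleftrightarrow> (\<forall>i. \<sigma> i permutes UNIV \<and> \<sigma> i \<noteq> id \<and> \<sigma> i i = i)"

text \<open>The automorphism \<open>a\<^sub>i\<close>; the recursion is the equation
  \<open>\<psi>(a\<^sub>i) = (1,\<dots>,a\<^sub>i,\<dots>,1) \<sigma>\<^sub>i\<close> evaluated letter by letter, see \<open>psi_hanoi_gen\<close> below.\<close>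

primrec hanoi_gen :: "('d \<Rightarrow> 'd \<Rightarrow> 'd) \<Rightarrow> 'd \<Rightarrow> 'd list \<Rightarrow> 'd list" where
  "hanoi_gen \<sigma> i [] = []"
| "hanoi_gen \<sigma> i (x # w) = \<sigma> i x # (if x = i then hanoi_gen \<sigma> i w else w)"

definition spinal_hanoi_group :: "('d \<Rightarrow> 'd \<Rightarrow> 'd) \<Rightarrow> ('d list \<Rightarrow> 'd list) monoid" where
  "spinal_hanoi_group \<sigma> = subgroup_generated Aut_tree (range (hanoi_gen \<sigma>))"

definition gen_order :: "('d \<Rightarrow> 'd \<Rightarrow> 'd) \<Rightarrow> 'd \<Rightarrow> nat" where
  "gen_order \<sigma> i = group.ord (spinal_hanoi_group \<sigma>) (hanoi_gen \<sigma> i)"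

definition eps_target :: "('d \<Rightarrow> 'd \<Rightarrow> 'd) \<Rightarrow> ('d \<Rightarrow> int) monoid" where
  "eps_target \<sigma> = product_group UNIV (\<lambda>i. integer_mod_group (gen_order \<sigma> i))"

definition std_gen :: "('d \<Rightarrow> 'd \<Rightarrow> 'd) \<Rightarrow> 'd \<Rightarrow> 'd \<Rightarrow> int" where
  "std_gen \<sigma> i = (\<lambda>k. if k = i then 1 mod int (gen_order \<sigma> i) else 0)"

text \<open>Members of \<open>hom\<close> are unconstrained outside the carrier, so extensionality is
  needed for the homomorphism to be unique as a HOL function.\<close>

definition eps :: "('d \<Rightarrow> 'd \<Rightarrow> 'd) \<Rightarrow> ('d list \<Rightarrow> 'd list) \<Rightarrow> 'd \<Rightarrow> int" where
  "eps \<sigma> = (THE h. h \<in> hom (spinal_hanoi_group \<sigma>) (eps_target \<sigma>)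
                 \<and> h \<in> extensional (carrier (spinal_hanoi_group \<sigma>))
                 \<and> (\<forall>i. h (hanoi_gen \<sigma> i) = std_gen \<sigma> i))"

lemma psi_hanoi_gen:
  "psi (hanoi_gen \<sigma> i) = ((\<lambda>j. if j = i then hanoi_gen \<sigma> i else id), \<sigma> i)"
  by (auto simp: psi_def tree_section_def first_level_action_def fun_eq_iff)

lemma length_hanoi_gen [simp]: "length (hanoi_gen \<sigma> i w) = length w"
  by (induction w) auto

lemma hanoi_gen_snoc: "\<exists>y. hanoi_gen \<sigma> i (v @ [x]) = hanoi_gen \<sigma> i v @ [y]"
  by (induction v) auto

lemma inj_hanoi_gen:
  assumes "inj (\<sigma> i)"
  shows "inj (hanoi_gen \<sigma> i)"
proof (rule injI)
  fix v w
  show "hanoi_gen \<sigma> i v = hanoi_gen \<sigma> i w \<Longrightarrow> v = w"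
  proof (induction v arbitrary: w)
    case Nil
    then show ?case by (cases w) auto
  next
    case (Cons x v)
    then obtain y u where w: "w = y # u"
      by (cases w) auto
    with Cons.prems have "x = y"
      using assms by (simp add: inj_eq)
    with Cons w show ?case by (auto split: if_splits)
  qed
qed

lemma surj_hanoi_gen:
  assumes "surj (\<sigma> i)"
  shows "surj (hanoi_gen \<sigma> i)"
proof -
  have "\<exists>v. hanoi_gen \<sigma> i v = w" for w
  proof (induction w)
    case Nil
    show ?case by (rule exI[of _ "[]"]) simp
  next
    case (Cons y w)
    obtain x where x: "\<sigma> i x = y"
      using assms by (metis surjD)
    obtain v where v: "hanoi_gen \<sigma> i v = w"
      using Cons.IH by blast
    show ?case
      using x v by (intro exI[of _ "x # (if x = i then v else w)"]) auto
  qed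
  then show ?thesis by (metis surjI)
qed

lemma tree_aut_hanoi_gen:
  assumes "spinal_hanoi_perms \<sigma>"
  shows "tree_aut (hanoi_gen \<sigma> i)"
proof -
  have perm: "bij (\<sigma> i)"
    using assms by (meson permutes_bij spinal_hanoi_perms_def)
  have inj: "inj (hanoi_gen \<sigma> i)" and surj: "surj (hanoi_gen \<sigma> i)"
    using perm by (simp_all add: bij_def inj_hanoi_gen surj_hanoi_gen)
  have "child_of w v" if "child_of (hanoi_gen \<sigma> i w) (hanoi_gen \<sigma> i v)" for v w
  proof -
    have "length w = Suc (length v)"
      using that unfolding child_of_def by (metis length_append_singleton length_hanoi_gen)
    then obtain u x where w: "w = u @ [x]"
      by (metis length_Suc_conv_rev)
    then have "hanoi_gen \<sigma> i u = hanoi_gen \<sigma> i v"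
      using that hanoi_gen_snoc[of \<sigma> i u x] by (auto simp: child_of_def)
    then show ?thesis
      using inj w by (auto simp: child_of_def inj_eq)
  qed
  moreover have "child_of (hanoi_gen \<sigma> i w) (hanoi_gen \<sigma> i v)" if "child_of w v" for v w
    using that hanoi_gen_snoc[of \<sigma> i v] by (auto simp: child_of_def)
  ultimately show ?thesis
    unfolding tree_aut_def bij_def using inj surj by (metis hanoi_gen.simps(1))
qed

lemma group_Aut_tree: "group Aut_tree"
proof (rule groupI)
  fix g :: "'a list \<Rightarrow> 'a list"
  assume "g \<in> carrier Aut_tree"
  then have g: "bij g" "g [] = []" "\<And>v w. child_of (g w) (g v) \<longleftrightarrow> child_of w v"
    by (auto simp: Aut_tree_def tree_aut_def)
  let ?h = "inv_into UNIV g"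
  have r: "g (?h v) = v" for v
    using g(1) by (simp add: bij_is_surj surj_f_inv_f)
  have "bij ?h"
    using g(1) by (rule bij_imp_bij_inv)
  moreover have "?h [] = []"
    using g(1,2) by (metis bij_is_inj inv_f_f)
  moreover have "child_of (?h w) (?h v) \<longleftrightarrow> child_of w v" for v w
    using g(3)[of "?h w" "?h v"] by (simp add: r)
  moreover have "g \<circ> ?h = id"
    by (simp add: fun_eq_iff r)
  ultimately show "\<exists>h\<in>carrier Aut_tree. h \<otimes>\<^bsub>Aut_tree\<^esub> g = \<one>\<^bsub>Aut_tree\<^esub>"
    by (intro bexI[of _ ?h]) (auto simp: Aut_tree_def tree_aut_def)
qed (auto simp: Aut_tree_def tree_aut_def bij_comp comp_assoc)

lemma group_spinal_hanoi_group: "group (spinal_hanoi_group \<sigma>)"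
  unfolding spinal_hanoi_group_def by (rule group.group_subgroup_generated[OF group_Aut_tree])

end

theory Submission
  imports Defs
begin

text \<open>
  The identity is obvious for words and becomes a statement about the group only once
  \<open>\<epsilon>\<close> is known to be well defined.  Since the only nontrivial first-level section of \<open>a\<^sub>i\<close> is \<open>a\<^sub>i\<close>
  itself, sitting over the letter \<open>i\<close>, each letter of a word \<open>w\<close> reappears in exactly one of the
  words that represent the sections of \<open>w\<close> over the letters of the alphabet.  Exponents of
  generators are therefore preserved when these section words are taken together
  (\<open>sum_count_word_section\<close>), and this is the claim for the exponent vector of \<open>w\<close>.

  It remains to see that a word acting trivially has exponent of \<open>a\<^sub>k\<close> divisible by \<open>o(a\<^sub>k)\<close>
  (\<open>gen_order_dvd_count_of_trivial_word\<close>).  Its section words act trivially too, and their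
  lengths add up to the length of \<open>w\<close>.  If all of them are shorter than \<open>w\<close>, induction on the
  length applies, by the preservation of exponents.  Otherwise all letters of \<open>w\<close> contribute to
  a single section over some \<open>j\<close>; the first letter must then be \<open>a\<^sub>j\<close>, which fixes \<open>j\<close>, so the
  second letter must be \<open>a\<^sub>j\<close>, and so on.  Hence \<open>w\<close> is a power of \<open>a\<^sub>j\<close>, and the
  divisibility is the definition of the order of \<open>a\<^sub>j\<close>.

  Words without inverse letters suffice: \<open>\<sigma>\<^sub>i\<close> has finite order, and a power of \<open>a\<^sub>i\<close> is trivial
  as soon as the same power of \<open>\<sigma>\<^sub>i\<close> is, because \<open>a\<^sub>i\<close> fixes \<open>i\<close>, acts
  below \<open>i\<close> as itself and has trivial sections over all other letters.
\<close>

section \<open>Words in the generators and their sections\<close>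

definition word_action :: "('d \<Rightarrow> 'd \<Rightarrow> 'd) \<Rightarrow> 'd list \<Rightarrow> 'd list \<Rightarrow> 'd list" where
  "word_action \<sigma> w = fold (hanoi_gen \<sigma>) w"

primrec word_section :: "('d \<Rightarrow> 'd \<Rightarrow> 'd) \<Rightarrow> 'd \<Rightarrow> 'd list \<Rightarrow> 'd list" where
  "word_section \<sigma> j [] = []"
| "word_section \<sigma> j (i # w) = (if i = j then [i] else []) @ word_section \<sigma> (\<sigma> i j) w"

lemma word_action_Nil [simp]: "word_action \<sigma> [] = id"
  by (simp add: word_action_def fun_eq_iff)

lemma word_action_Cons: "word_action \<sigma> (i # w) = word_action \<sigma> w \<circ> hanoi_gen \<sigma> i"
  by (simp add: word_action_def)

lemma word_action_append: "word_action \<sigma> (u @ w) = word_action \<sigma> w \<circ> word_action \<sigma> u"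
  by (simp add: word_action_def fun_eq_iff)

lemma word_action_at_root [simp]: "word_action \<sigma> w [] = []"
  by (induction w) (auto simp: word_action_Cons)

lemma word_action_below_letter:
  "word_action \<sigma> w (j # v) = fold \<sigma> w j # word_action \<sigma> (word_section \<sigma> j w) v"
  by (induction w arbitrary: j v) (auto simp: word_action_Cons)

lemma tree_section_word_action:
  "tree_section (word_action \<sigma> w) [j] = word_action \<sigma> (word_section \<sigma> j w)"
  by (simp add: tree_section_def word_action_below_letter fun_eq_iff)

text \<open>After the letter \<open>i\<close> has been read, the rest of the word contributes to the section over
  \<open>j\<close> through the letter \<open>\<sigma> i j\<close>; as \<open>\<sigma> i\<close> is a bijection, this only permutes the summands.\<close>

lemma sum_count_word_section:
  fixes \<sigma> :: "'d::finite \<Rightarrow> 'd \<Rightarrow> 'd"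
  assumes "spinal_hanoi_perms \<sigma>"
  shows "(\<Sum>j\<in>UNIV. count_list (word_section \<sigma> j w) k) = count_list w k"
proof (induction w)
  case Nil
  show ?case by simp
next
  case (Cons i w)
  have "bij (\<sigma> i)"
    using assms by (meson permutes_bij spinal_hanoi_perms_def)
  then have "(\<Sum>j\<in>UNIV. count_list (word_section \<sigma> (\<sigma> i j) w) k)
      = (\<Sum>j\<in>UNIV. count_list (word_section \<sigma> j w) k)"
    by (rule sum.reindex_bij_betw)
  moreover have "count_list (word_section \<sigma> j (i # w)) k =
      (if j = i then (if i = k then 1 else 0) else 0) + count_list (word_section \<sigma> (\<sigma> i j) w) k" for j
    by simp
  ultimately show ?case
    by (simp add: sum.distrib Cons.IH del: word_section.simps)
qed

lemma length_word_section_le: "length (word_section \<sigma> j w) \<le> length w"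
proof (induction w arbitrary: j)
  case (Cons i w)
  show ?case using Cons.IH[of "\<sigma> i j"] by auto
qed simp

text \<open>A letter \<open>i \<noteq> j\<close> read at \<open>j\<close> is lost to the section for good, whereas \<open>a\<^sub>j\<close> fixes \<open>j\<close>; so a
  section word of full length pins down the whole word.\<close>

lemma full_length_section_imp_power:
  assumes "spinal_hanoi_perms \<sigma>" and "length (word_section \<sigma> j w) = length w"
  shows "w = replicate (length w) j"
  using assms(2)
proof (induction w)
  case (Cons i w)
  have "i = j"
  proof (rule ccontr)
    assume "i \<noteq> j"
    then show False
      using Cons.prems length_word_section_le[of \<sigma> "\<sigma> i j" w] by simp
  qed
  moreover have "\<sigma> j j = j"
    using assms(1) by (simp add: spinal_hanoi_perms_def)
  ultimately show ?case
    using Cons by simp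
qed simp

section \<open>Positive words represent every group element\<close>

lemma one_Aut_tree [simp]: "\<one>\<^bsub>Aut_tree\<^esub> = id"
  by (simp add: Aut_tree_def)

lemma mult_Aut_tree [simp]: "g \<otimes>\<^bsub>Aut_tree\<^esub> h = h \<circ> g"
  by (simp add: Aut_tree_def)

lemma one_spinal_hanoi_group [simp]: "\<one>\<^bsub>spinal_hanoi_group \<sigma>\<^esub> = id"
  by (simp add: spinal_hanoi_group_def)

lemma mult_spinal_hanoi_group [simp]: "g \<otimes>\<^bsub>spinal_hanoi_group \<sigma>\<^esub> h = h \<circ> g"
  by (simp add: spinal_hanoi_group_def)

lemma hanoi_gen_in_Aut_tree:
  "spinal_hanoi_perms \<sigma> \<Longrightarrow> hanoi_gen \<sigma> i \<in> carrier Aut_tree"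
  using tree_aut_hanoi_gen by (simp add: Aut_tree_def)

lemma hanoi_gen_in_spinal_hanoi_group:
  assumes "spinal_hanoi_perms \<sigma>"
  shows "hanoi_gen \<sigma> i \<in> carrier (spinal_hanoi_group \<sigma>)"
  using hanoi_gen_in_Aut_tree[OF assms]
  by (auto simp: spinal_hanoi_group_def carrier_subgroup_generated intro!: generate.incl)

lemma word_action_in_spinal_hanoi_group:
  assumes "spinal_hanoi_perms \<sigma>"
  shows "word_action \<sigma> w \<in> carrier (spinal_hanoi_group \<sigma>)"
proof (induction w)
  case Nil
  show ?case
    using group.is_monoid[OF group_spinal_hanoi_group, THEN monoid.one_closed, of \<sigma>]
    by (simp only: word_action_Nil one_spinal_hanoi_group)
next
  case (Cons i w)
  then show ?case
    using group.is_monoid[OF group_spinal_hanoi_group, THEN monoid.m_closed,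
        OF hanoi_gen_in_spinal_hanoi_group[OF assms] Cons]
    by (simp only: word_action_Cons mult_spinal_hanoi_group)
qed

lemma word_action_replicate:
  "word_action \<sigma> (replicate n i) = hanoi_gen \<sigma> i [^]\<^bsub>spinal_hanoi_group \<sigma>\<^esub> n"
proof -
  have "hanoi_gen \<sigma> i [^]\<^bsub>spinal_hanoi_group \<sigma>\<^esub> n = hanoi_gen \<sigma> i ^^ n"
    by (induction n) (simp_all only: nat_pow_0 nat_pow_Suc funpow.simps
        one_spinal_hanoi_group mult_spinal_hanoi_group)
  then show ?thesis by (simp add: word_action_def fold_replicate)
qed

text \<open>Along a vertex, a power of \<open>a\<^sub>i\<close> acts as the same power of \<open>\<sigma>\<^sub>i\<close>, letter by letter, as long
  as only letters \<open>i\<close> have been read, and trivially from there on.\<close>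

lemma word_action_replicate_eq_id:
  assumes "spinal_hanoi_perms \<sigma>" and "\<sigma> i ^^ n = id"
  shows "word_action \<sigma> (replicate n i) = id"
proof -
  have fix_i: "\<sigma> i i = i"
    using assms(1) by (simp add: spinal_hanoi_perms_def)
  have inj: "inj (\<sigma> i)"
    using assms(1) by (meson permutes_inj spinal_hanoi_perms_def)
  have sec_i: "word_section \<sigma> i (replicate m i) = replicate m i" for m
    by (induction m) (auto simp: fix_i)
  have sec_other: "word_section \<sigma> x (replicate m i) = []" if "x \<noteq> i" for m x
    using that
  proof (induction m arbitrary: x)
    case (Suc m)
    then have "\<sigma> i x \<noteq> i"
      using inj fix_i by (metis injD)
    then show ?case using Suc by simp
  qed simp
  have act: "(\<sigma> i ^^ n) x = x" for x
    using assms(2) by simp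
  have "word_action \<sigma> (replicate n i) v = v" for v
  proof (induction v)
    case (Cons x v)
    then show ?case
      by (cases "x = i") (simp_all add: word_action_below_letter fold_replicate act sec_i sec_other)
  qed simp
  then show ?thesis by (simp add: fun_eq_iff)
qed

lemma inv_hanoi_gen_is_word:
  fixes \<sigma> :: "'d::finite \<Rightarrow> 'd \<Rightarrow> 'd"
  assumes "spinal_hanoi_perms \<sigma>"
  shows "\<exists>w. inv\<^bsub>Aut_tree\<^esub> (hanoi_gen \<sigma> i) = word_action \<sigma> w"
proof -
  have "\<sigma> i permutes UNIV"
    using assms by (simp add: spinal_hanoi_perms_def)
  then have "permutation (\<sigma> i)"
    unfolding permutation_permutes by (intro exI[of _ UNIV]) simp
  then obtain n where n: "\<sigma> i ^^ n = id" "n > 0"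
    by (rule permutation_is_nilpotent)
  then obtain m where m: "n = Suc m"
    by (cases n) auto
  have "hanoi_gen \<sigma> i \<circ> word_action \<sigma> (replicate m i) = word_action \<sigma> (replicate m i @ [i])"
    by (simp add: word_action_append word_action_Cons)
  also have "\<dots> = id"
    using word_action_replicate_eq_id[OF assms n(1)] m by (simp add: replicate_append_same)
  finally have eq: "hanoi_gen \<sigma> i \<circ> word_action \<sigma> (replicate m i) = id" .
  have "word_action \<sigma> (replicate m i) \<in> carrier Aut_tree"
    using word_action_in_spinal_hanoi_group[OF assms]
      group.carrier_subgroup_generated_subset[OF group_Aut_tree]
    unfolding spinal_hanoi_group_def by blast
  then have "inv\<^bsub>Aut_tree\<^esub> (hanoi_gen \<sigma> i) = word_action \<sigma> (replicate m i)"
    using eq hanoi_gen_in_Aut_tree[OF assms]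
    by (intro group.inv_equality[OF group_Aut_tree]) simp_all
  then show ?thesis by blast
qed

lemma spinal_hanoi_group_element_is_word:
  fixes \<sigma> :: "'d::finite \<Rightarrow> 'd \<Rightarrow> 'd"
  assumes "spinal_hanoi_perms \<sigma>" and "g \<in> carrier (spinal_hanoi_group \<sigma>)"
  shows "\<exists>w. g = word_action \<sigma> w"
proof -
  have "g \<in> generate Aut_tree (carrier Aut_tree \<inter> range (hanoi_gen \<sigma>))"
    using assms(2) by (simp add: spinal_hanoi_group_def carrier_subgroup_generated)
  then show ?thesis
  proof (induction rule: generate.induct)
    case one
    show ?case by (intro exI[of _ "[]"]) simp
  next
    case (incl h)
    then obtain i where "h = hanoi_gen \<sigma> i" by blast
    then show ?case by (intro exI[of _ "[i]"]) (simp add: word_action_Cons)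
  next
    case (inv h)
    then show ?case using inv_hanoi_gen_is_word[OF assms(1)] by blast
  next
    case (eng h1 h2)
    then show ?case using word_action_append by (metis mult_Aut_tree)
  qed
qed

section \<open>The exponent vector is an invariant of the group element\<close>

definition exponent_vector :: "('d \<Rightarrow> 'd \<Rightarrow> 'd) \<Rightarrow> 'd list \<Rightarrow> 'd \<Rightarrow> int" where
  "exponent_vector \<sigma> w k = int (count_list w k) mod int (gen_order \<sigma> k)"

text \<open>Induction on the length: either every section word is shorter, and the exponents of \<open>w\<close>
  are sums of exponents of shorter trivial words, or one section word is as long as \<open>w\<close> and
  \<open>w\<close> is a power of a generator.\<close>

lemma gen_order_dvd_count_of_trivial_word:
  fixes \<sigma> :: "'d::finite \<Rightarrow> 'd \<Rightarrow> 'd"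
  assumes "spinal_hanoi_perms \<sigma>" and "word_action \<sigma> w = id"
  shows "gen_order \<sigma> k dvd count_list w k"
  using assms(2)
proof (induction "length w" arbitrary: w rule: less_induct)
  case less
  have trivial_section: "word_action \<sigma> (word_section \<sigma> j w) = id" for j
  proof
    fix v
    show "word_action \<sigma> (word_section \<sigma> j w) v = id v"
      using word_action_below_letter[of \<sigma> w j v] less.prems by simp
  qed
  show ?case
  proof (cases "\<exists>j. length (word_section \<sigma> j w) = length w")
    case True
    then obtain j where w: "w = replicate (length w) j"
      using full_length_section_imp_power[OF assms(1)] by blast
    show ?thesis
    proof (cases "k = j")
      case True
      have "hanoi_gen \<sigma> j [^]\<^bsub>spinal_hanoi_group \<sigma>\<^esub> length w = \<one>\<^bsub>spinal_hanoi_group \<sigma>\<^esub>"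
        using less.prems word_action_replicate[of \<sigma> "length w" j] w by simp
      then have "gen_order \<sigma> j dvd length w"
        unfolding gen_order_def
        using group.pow_eq_id[OF group_spinal_hanoi_group hanoi_gen_in_spinal_hanoi_group[OF assms(1)]]
        by blast
      moreover have "count_list (replicate n j) j = n" for n
        by (induction n) auto
      ultimately show ?thesis
        using True w by metis
    next
      case False
      then have "count_list (replicate n j) k = 0" for n
        by (induction n) auto
      then show ?thesis
        using w by (metis dvd_0_right)
    qed
  next
    case False
    then have "length (word_section \<sigma> j w) < length w" for j
      using length_word_section_le[of \<sigma> j w] by (metis le_neq_implies_less)
    then have "gen_order \<sigma> k dvd count_list (word_section \<sigma> j w) k" for j
      using less.hyps trivial_section by blast
    then have "gen_order \<sigma> k dvd (\<Sum>j\<in>UNIV. count_list (word_section \<sigma> j w) k)"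
      by (rule dvd_sum)
    then show ?thesis
      by (simp add: sum_count_word_section[OF assms(1)])
  qed
qed

text \<open>Two words with the same action are compared by completing both to trivial words with a
  common tail that represents the inverse.\<close>

lemma exponent_vector_cong:
  fixes \<sigma> :: "'d::finite \<Rightarrow> 'd \<Rightarrow> 'd"
  assumes "spinal_hanoi_perms \<sigma>" and "word_action \<sigma> w = word_action \<sigma> w'"
  shows "exponent_vector \<sigma> w = exponent_vector \<sigma> w'"
proof
  fix k
  let ?G = "spinal_hanoi_group \<sigma>"
  have w: "word_action \<sigma> w \<in> carrier ?G"
    by (rule word_action_in_spinal_hanoi_group[OF assms(1)])
  obtain u where u: "inv\<^bsub>?G\<^esub> (word_action \<sigma> w) = word_action \<sigma> u"
    using spinal_hanoi_group_element_is_word[OF assms(1)]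
      group.inv_closed[OF group_spinal_hanoi_group w] by blast
  have "word_action \<sigma> (w @ u) = id"
    using group.r_inv[OF group_spinal_hanoi_group w] u by (simp add: word_action_append)
  moreover from this have "word_action \<sigma> (w' @ u) = id"
    using assms(2) by (simp add: word_action_append)
  ultimately have "gen_order \<sigma> k dvd count_list w k + count_list u k"
      and "gen_order \<sigma> k dvd count_list w' k + count_list u k"
    using gen_order_dvd_count_of_trivial_word[OF assms(1), of _ k]
    by (metis count_list_append)+
  then have "int (gen_order \<sigma> k) dvd
      int (count_list w k + count_list u k) - int (count_list w' k + count_list u k)"
    by (intro dvd_diff) (simp_all only: int_dvd_int_iff)
  then show "exponent_vector \<sigma> w k = exponent_vector \<sigma> w' k"
    by (simp add: exponent_vector_def mod_eq_dvd_iff)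
qed

lemma mult_eps_target:
  "x \<otimes>\<^bsub>eps_target \<sigma>\<^esub> y = (\<lambda>k. (x k + y k) mod int (gen_order \<sigma> k))"
  by (simp add: eps_target_def restrict_def)

lemma one_eps_target: "\<one>\<^bsub>eps_target \<sigma>\<^esub> = (\<lambda>k. 0)"
  by (simp add: eps_target_def restrict_def)

lemma group_eps_target: "group (eps_target \<sigma>)"
  by (simp add: eps_target_def)

lemma comm_group_eps_target: "comm_group (eps_target \<sigma>)"
  by (rule group.group_comm_groupI[OF group_eps_target])
    (simp add: mult_eps_target add.commute)

lemma exponent_vector_in_eps_target: "exponent_vector \<sigma> w \<in> carrier (eps_target \<sigma>)"
  by (simp add: eps_target_def exponent_vector_def carrier_integer_mod_group PiE_iff)

lemma exponent_vector_append:
  "exponent_vector \<sigma> (u @ w) = exponent_vector \<sigma> u \<otimes>\<^bsub>eps_target \<sigma>\<^esub> exponent_vector \<sigma> w"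
  by (simp add: mult_eps_target exponent_vector_def fun_eq_iff mod_add_eq)

lemma exponent_vector_Nil: "exponent_vector \<sigma> [] = \<one>\<^bsub>eps_target \<sigma>\<^esub>"
  by (simp add: one_eps_target exponent_vector_def fun_eq_iff)

lemma exponent_vector_singleton: "exponent_vector \<sigma> [i] = std_gen \<sigma> i"
  by (auto simp: std_gen_def exponent_vector_def fun_eq_iff)

lemma finprod_exponent_vector:
  assumes "finite A"
  shows "(\<Otimes>\<^bsub>eps_target \<sigma>\<^esub>j\<in>A. exponent_vector \<sigma> (ws j))
    = (\<lambda>k. int (\<Sum>j\<in>A. count_list (ws j) k) mod int (gen_order \<sigma> k))"
  using assms
proof (induction A rule: finite_induct)
  interpret comm_group "eps_target \<sigma>"
    by (rule comm_group_eps_target)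
  {
    case empty
    show ?case by (simp add: one_eps_target)
  next
    case (insert a A)
    then show ?case
      by (simp add: exponent_vector_in_eps_target mult_eps_target fun_eq_iff)
        (simp add: exponent_vector_def mod_add_eq)
  }
qed

section \<open>Evaluating the homomorphism on words\<close>

text \<open>The defining properties of \<open>\<epsilon>\<close> force its value on every word.\<close>

lemma hom_on_word_action:
  assumes "spinal_hanoi_perms \<sigma>"
    and "h \<in> hom (spinal_hanoi_group \<sigma>) (eps_target \<sigma>)"
    and "\<And>i. h (hanoi_gen \<sigma> i) = std_gen \<sigma> i"
  shows "h (word_action \<sigma> w) = exponent_vector \<sigma> w"
proof (induction w)
  case Nil
  show ?case
    using hom_one[OF assms(2) group_spinal_hanoi_group group_eps_target]
    by (simp only: word_action_Nil exponent_vector_Nil one_spinal_hanoi_group)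
next
  case (Cons i w)
  have "h (word_action \<sigma> (i # w)) = h (hanoi_gen \<sigma> i) \<otimes>\<^bsub>eps_target \<sigma>\<^esub> h (word_action \<sigma> w)"
    using hom_mult[OF assms(2) hanoi_gen_in_spinal_hanoi_group[OF assms(1)]
        word_action_in_spinal_hanoi_group[OF assms(1)]]
    by (simp add: word_action_Cons)
  also have "\<dots> = exponent_vector \<sigma> ([i] @ w)"
    by (simp only: exponent_vector_append assms(3) Cons.IH exponent_vector_singleton)
  finally show ?case by simp
qed

lemma eps_word_action:
  fixes \<sigma> :: "'d::finite \<Rightarrow> 'd \<Rightarrow> 'd"
  assumes "spinal_hanoi_perms \<sigma>"
  shows "eps \<sigma> (word_action \<sigma> w) = exponent_vector \<sigma> w"
proof -
  let ?G = "spinal_hanoi_group \<sigma>"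
  let ?P = "\<lambda>h. h \<in> hom ?G (eps_target \<sigma>) \<and> h \<in> extensional (carrier ?G)
                 \<and> (\<forall>i. h (hanoi_gen \<sigma> i) = std_gen \<sigma> i)"
  define e where
    "e = (\<lambda>g\<in>carrier ?G. exponent_vector \<sigma> (SOME w. g = word_action \<sigma> w))"
  have e: "e (word_action \<sigma> w) = exponent_vector \<sigma> w" for w
  proof -
    have "word_action \<sigma> w = word_action \<sigma> (SOME u. word_action \<sigma> w = word_action \<sigma> u)"
      by (rule someI[where P = "\<lambda>u. word_action \<sigma> w = word_action \<sigma> u"]) (rule refl)
    from exponent_vector_cong[OF assms this] show ?thesis
      by (simp add: e_def word_action_in_spinal_hanoi_group[OF assms])
  qed
  have "e \<in> hom ?G (eps_target \<sigma>)"
  proof (rule homI)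
    fix x assume "x \<in> carrier ?G"
    then show "e x \<in> carrier (eps_target \<sigma>)"
      by (simp add: e_def exponent_vector_in_eps_target)
  next
    fix x y assume "x \<in> carrier ?G" "y \<in> carrier ?G"
    then obtain u w where "x = word_action \<sigma> u" "y = word_action \<sigma> w"
      using spinal_hanoi_group_element_is_word[OF assms] by blast
    then show "e (x \<otimes>\<^bsub>?G\<^esub> y) = e x \<otimes>\<^bsub>eps_target \<sigma>\<^esub> e y"
      by (simp add: e exponent_vector_append flip: word_action_append)
  qed
  moreover have "e (hanoi_gen \<sigma> i) = std_gen \<sigma> i" for i
    using e[of "[i]"] by (simp add: word_action_Cons exponent_vector_singleton)
  ultimately have "?P e"
    by (simp add: e_def)
  moreover have "h = e" if "?P h" for h
  proof (rule extensionalityI[of _ "carrier ?G"])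
    fix x assume "x \<in> carrier ?G"
    then obtain w where "x = word_action \<sigma> w"
      using spinal_hanoi_group_element_is_word[OF assms] by blast
    then show "h x = e x"
      using that hom_on_word_action[OF assms, of h w] e by simp
  qed (use that in \<open>simp_all add: e_def\<close>)
  ultimately have "eps \<sigma> = e"
    unfolding eps_def by (rule the_equality)
  then show ?thesis by (simp add: e)
qed

theorem corollary3p9:
  fixes \<sigma> :: "'d::finite \<Rightarrow> 'd \<Rightarrow> 'd"
    and g :: "'d list \<Rightarrow> 'd list"
    and gs :: "'d \<Rightarrow> 'd list \<Rightarrow> 'd list"
  assumes "spinal_hanoi_perms \<sigma>"
    and "g \<in> level_one_stabilizer (spinal_hanoi_group \<sigma>)"
    and "psi g = (gs, id)"
  shows "eps \<sigma> g = (\<Otimes>\<^bsub>eps_target \<sigma>\<^esub>j\<in>UNIV. eps \<sigma> (gs j))"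
proof -
  obtain w where w: "g = word_action \<sigma> w"
    using assms(2) spinal_hanoi_group_element_is_word[OF assms(1)]
    by (auto simp: level_one_stabilizer_def)
  have gs: "gs = (\<lambda>j. word_action \<sigma> (word_section \<sigma> j w))"
    using assms(3) by (simp add: psi_def w tree_section_word_action)
  show ?thesis
    unfolding w gs
    by (simp add: eps_word_action[OF assms(1)] finprod_exponent_vector
        sum_count_word_section[OF assms(1)] exponent_vector_def fun_eq_iff del: of_nat_sum)
qed

end
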